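(* For each real number $p>\frac23$ there is a constant $c>0$ such that for all measurable sets $E\subset[0,1)$ and all sequences $(a_I)_{I\in\mathcal D}$ of real numbers with $a_I=0$ whenever $|I\cap E|<p|I|$, we have $$\Bigl\|\sum_{I\in\mathcal D}a_Ih_I 1_E\Bigr\|_2^2\geq c\sum_{I\in\mathcal D}\|a_Ih_I 1_E\|_2^2,$$ whenever the right-hand side is finite. For each $p\leq\frac23$ there is no such constant $c>0$; that is, for no $c>0$ does the inequality $\bigl\|\sum_{I\in\mathcal D}a_Ih_I 1_E\bigr\|_2^2\geq c\sum_{I\in\mathcal D}\|a_Ih_I 1_E\|_2^2$ hold for all measurable $E\subset[0,1)$ and all sequences $(a_I)_{I\in\mathcal D}$ with $a_I=0$ whenever $|I\cap E|<p|I|$ and with finite right-hand side.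
   Context: $\mathcal D=\{[k2^n,(k+1)2^n) : n,k\in\mathbb Z\}$ is the set of dyadic intervals. For an interval $I=[a,b)$, its left and right halves are $I^{\mathrm l}=[a,\frac{a+b}2)$ and $I^{\mathrm r}=[\frac{a+b}2,b)$, and its Haar function is $h_I=-1_{I^{\mathrm l}}+1_{I^{\mathrm r}}$, where $1_A$ denotes the indicator function of $A$. $|A|$ is the Lebesgue measure of $A$, and $\|\cdot\|_2$ is the norm of $L^2(\mathbb R)$ with respect to Lebesgue measure. The infinite sum on the left-hand side is understood as an (unconditional) limit in $L^2$ of finite partial sums; for $p>0$ it converges in $L^2$ whenever the right-hand side is finite. *)

theory Defs
  imports "HOL-Analysis.Analysis"
begin

definition dyadic :: "real set set" where
  "dyadic = {{real_of_int k * 2 powi n ..< real_of_int (k + 1) * 2 powi n} | n k :: int. True}"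

text \<open>The intervals are half-open: \<open>I = {a..<b}\<close> with \<open>a < b\<close>, so \<open>a = Inf I\<close> and \<open>b = Sup I\<close>.\<close>

definition left_half :: "real set \<Rightarrow> real set" where
  "left_half I = {Inf I ..< (Inf I + Sup I) / 2}"

definition right_half :: "real set \<Rightarrow> real set" where
  "right_half I = {(Inf I + Sup I) / 2 ..< Sup I}"

definition haar :: "real set \<Rightarrow> real \<Rightarrow> real" where
  "haar I x = - indicator (left_half I) x + indicator (right_half I) x"

definition haar_term :: "real set \<Rightarrow> (real set \<Rightarrow> real) \<Rightarrow> real set \<Rightarrow> real \<Rightarrow> real" where
  "haar_term E a I = (\<lambda>x. a I * haar I x * indicator E x)"

definition square_integrable :: "(real \<Rightarrow> real) \<Rightarrow> bool" where
  "square_integrable f \<longleftrightarrow>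
     f \<in> borel_measurable lebesgue \<and> integrable lebesgue (\<lambda>x. (f x)\<^sup>2)"

text \<open>Only meaningful for square integrable functions: the Bochner integral of a
  non-integrable function is \<open>0\<close>.\<close>

definition L2_norm :: "(real \<Rightarrow> real) \<Rightarrow> real" where
  "L2_norm f = sqrt (LINT x|lebesgue. (f x)\<^sup>2)"

text \<open>Unconditional convergence in \<open>L\<^sup>2\<close>: the finite partial sums converge to \<open>f\<close> along the
  directed set of finite subsets of the index set. The limit \<open>f\<close> is determined only up to
  null sets.\<close>

definition L2_has_sum :: "('i \<Rightarrow> real \<Rightarrow> real) \<Rightarrow> (real \<Rightarrow> real) \<Rightarrow> 'i set \<Rightarrow> bool" where
  "L2_has_sum g f A \<longleftrightarrow>
     (\<forall>i\<in>A. square_integrable (g i)) \<and> square_integrable f \<and>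
     ((\<lambda>F. L2_norm (\<lambda>x. (\<Sum>i\<in>F. g i x) - f x)) \<longlongrightarrow> 0) (finite_subsets_at_top A)"

definition admissible :: "real \<Rightarrow> real set \<Rightarrow> (real set \<Rightarrow> real) \<Rightarrow> bool" where
  "admissible p E a \<longleftrightarrow>
     E \<in> sets lebesgue \<and> E \<subseteq> {0..<1} \<and>
     (\<forall>I\<in>dyadic. measure lebesgue (I \<inter> E) < p * measure lebesgue I \<longrightarrow> a I = 0)"

end

theory Submission
  imports Defs
begin

text \<open>
  The lower bound for \<open>p > 2 / 3\<close> is proved by a Bellman function. A finite partial sum of the series
  is followed down the tree of dyadic intervals: on an interval \<open>J\<close> the terms of the larger intervals
  add up to a constant \<open>x\<close>, and the term of \<open>J\<close> sends \<open>x\<close> to \<open>x - b\<close> on the left half and \<open>x + b\<close> on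
  the right half, where \<open>b\<close> may be nonzero only if \<open>E\<close> has density at least \<open>p\<close> in \<open>J\<close>. What is left
  to find is a function of the density that, multiplied by \<open>x\<^sup>2\<close> and by the length of \<open>J\<close>, stays below
  the integral of the square of the sum over \<open>J \<inter> E\<close>. Such a function has to be midpoint convex at
  densities below \<open>p\<close>, to stay below the harmonic mean of its values at the two halves at densities
  from \<open>p\<close> on, and to lie below the density itself (lemmas \<open>bellman_split\<close> and \<open>bellman_le\<close>). It has to
  be positive down to density \<open>2 * p - 1\<close>. A function that is affine with a small slope up to \<open>p\<close> and
  then the reciprocal of an affine function does this exactly when \<open>p > 2 / 3\<close>: in the
  limit of vanishing slope the harmonic condition at \<open>p\<close> reads \<open>1 / p \<ge> 1 / (2 * (2 * p - 1))\<close>.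

  To compare with the sum of the squared terms, the measure on \<open>E\<close> is replaced by the signed weight
  \<open>indicator E - d\<^sup>2\<close> with a small \<open>d > 0\<close>. As the Haar system is orthogonal, nonnegativity of the weighted integral of the
  square is the claim with constant \<open>d\<^sup>2\<close>, and the induction along the tree (\<open>energy_lower_bound\<close>)
  remains the same. The step from finite sums to the series uses the completeness of \<open>L\<^sup>2\<close> and
  the matching upper bound (\<open>haar_sum_norm_bounds\<close>, \<open>L2_has_sum_exists\<close>).

  For \<open>p \<le> 2 / 3\<close> the extremal situation of that induction is iterated. The set \<open>E\<close> has density
  \<open>2 / 3\<close> in each interval \<open>[0, 4^-k)\<close>; its right half belongs to \<open>E\<close>, and in its left half \<open>E\<close> is the
  next smaller copy in the left quarter. The coefficients \<open>-(2 ^ k)\<close> cancel the sum on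
  the right half up to a constant and double it on the left half. Each term then has squared norm
  \<open>2 / 3\<close>, whereas the sum has squared norm at most \<open>4 / 3\<close>, whatever the number of terms is.
\<close>

section \<open>Dyadic intervals and Haar functions\<close>

definition dyad :: "int \<Rightarrow> int \<Rightarrow> real set" where
  "dyad n k = {real_of_int k * 2 powi n ..< real_of_int (k + 1) * 2 powi n}"

lemma dyadic_iff: "I \<in> dyadic \<longleftrightarrow> (\<exists>n k. I = dyad n k)"
  by (auto simp: dyadic_def dyad_def)

lemma dyad_bounds: "real_of_int k * 2 powi n < real_of_int (k + 1) * 2 powi n"
  by (simp add: algebra_simps)

lemma Inf_dyad [simp]: "Inf (dyad n k) = real_of_int k * 2 powi n"
  unfolding dyad_def using dyad_bounds by (rule cInf_atLeastLessThan)

lemma Sup_dyad [simp]: "Sup (dyad n k) = real_of_int (k + 1) * 2 powi n"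
  unfolding dyad_def using dyad_bounds by (rule cSup_atLeastLessThan)

lemma measure_dyad [simp]: "measure lebesgue (dyad n k) = 2 powi n"
  using dyad_bounds[of k n] by (simp add: dyad_def algebra_simps)

lemma powi_pred: "(2::real) powi (n - 1) = 2 powi n / 2"
  by (simp add: power_int_diff)

lemma left_half_dyad: "left_half (dyad n k) = dyad (n - 1) (2 * k)"
  unfolding left_half_def Inf_dyad Sup_dyad
  by (simp add: dyad_def powi_pred field_simps)

lemma right_half_dyad: "right_half (dyad n k) = dyad (n - 1) (2 * k + 1)"
  unfolding right_half_def Inf_dyad Sup_dyad
  by (simp add: dyad_def powi_pred add_divide_distrib distrib_left distrib_right add.commute)

text \<open>Measured in units of the length of the shorter interval, the longer one has integer endpoints,
  and no integer lies strictly inside the shorter one.\<close>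

lemma dyad_nested:
  assumes "m \<le> n"
  shows "dyad m j \<subseteq> dyad n k \<or> dyad m j \<inter> dyad n k = {}"
proof -
  define q where "q = nat (n - m)"
  have n: "2 powi n = 2 ^ q * (2::real) powi m"
    using assms by (simp add: q_def flip: power_int_of_nat power_int_add)
  have scale: "real_of_int i * 2 powi n = real_of_int (i * 2 ^ q) * 2 powi m" for i
    by (simp add: n)
  have le: "real_of_int u * 2 powi m \<le> real_of_int v * 2 powi m" if "u \<le> v" for u v
    using that by (intro mult_right_mono) auto
  consider "j + 1 \<le> k * 2 ^ q" | "(k + 1) * 2 ^ q \<le> j"
    | "k * 2 ^ q \<le> j" "j + 1 \<le> (k + 1) * 2 ^ q" by linarith
  then show ?thesis
  proof cases
    case 1
    then show ?thesis unfolding dyad_def scale using le[OF 1] by auto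
  next
    case 2
    then show ?thesis unfolding dyad_def scale using le[OF 2] by auto
  next
    case 3
    then show ?thesis unfolding dyad_def scale using le[OF 3(1)] le[OF 3(2)] by auto
  qed
qed

lemma dyadic_nonempty: "I \<in> dyadic \<Longrightarrow> I \<noteq> {}"
  using dyad_bounds by (auto simp: dyadic_iff dyad_def)

lemma half_dyadic [simp]:
  assumes "J \<in> dyadic" shows "left_half J \<in> dyadic" "right_half J \<in> dyadic"
  using assms dyadic_iff left_half_dyad right_half_dyad by metis+

lemma dyadic_halves:
  assumes "J \<in> dyadic"
  shows "J = left_half J \<union> right_half J" "left_half J \<inter> right_half J = {}"
proof -
  obtain n k where J: "J = dyad n k" using assms by (auto simp: dyadic_iff)
  have "real_of_int (2 * k) * 2 powi (n - 1) \<le> real_of_int (2 * k + 1) * 2 powi (n - 1)"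
     "real_of_int (2 * k + 1) * 2 powi (n - 1) \<le> real_of_int (2 * k + 2) * 2 powi (n - 1)"
    by (intro mult_right_mono; simp)+
  then show "J = left_half J \<union> right_half J" "left_half J \<inter> right_half J = {}"
    unfolding J left_half_dyad right_half_dyad
    by (auto simp: dyad_def powi_pred field_simps)
qed

lemma dyadic_measurable [measurable]: "J \<in> dyadic \<Longrightarrow> J \<in> sets lebesgue"
  by (auto simp: dyadic_iff dyad_def)

lemma dyadic_fmeasurable: "J \<in> dyadic \<Longrightarrow> J \<in> lmeasurable"
  by (auto simp: dyadic_iff dyad_def intro!: bounded_set_imp_lmeasurable)

lemma measure_dyadic_pos: "J \<in> dyadic \<Longrightarrow> 0 < measure lebesgue J"
  by (auto simp: dyadic_iff)

lemma measure_half: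
  assumes "J \<in> dyadic"
  shows "measure lebesgue (left_half J) = measure lebesgue J / 2"
    "measure lebesgue (right_half J) = measure lebesgue J / 2"
  using assms by (auto simp: dyadic_iff left_half_dyad right_half_dyad powi_pred)

lemma dyadic_subset_cases:
  assumes "I \<in> dyadic" "J \<in> dyadic" "I \<subseteq> J"
  shows "I = J \<or> I \<subseteq> left_half J \<or> I \<subseteq> right_half J"
proof -
  obtain m j n k where IJ: "I = dyad m j" "J = dyad n k"
    using assms by (auto simp: dyadic_iff)
  have "measure lebesgue I \<le> measure lebesgue J"
    using assms by (intro measure_mono_fmeasurable dyadic_fmeasurable) auto
  then have "m \<le> n"
    using power_int_strict_increasing[of n m "2::real"] by (force simp: IJ not_less[symmetric])
  show ?thesis
  proof (cases "m = n")
    case True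
    have "j = k"
    proof (rule ccontr)
      assume "j \<noteq> k"
      then have "real_of_int (j+1) * 2 powi n \<le> k * 2 powi n \<or> real_of_int (k+1) * 2 powi n \<le> j * 2 powi n"
        by (auto simp: mult_le_cancel_right not_less[symmetric])
      then have "I \<inter> J = {}" by (auto simp: IJ True dyad_def)
      then show False using assms dyadic_nonempty[of I] by auto
    qed
    then show ?thesis by (simp add: IJ True)
  next
    case False
    then have "m \<le> n - 1" using \<open>m \<le> n\<close> by simp
    from dyad_nested[OF this, of j "2*k"] dyad_nested[OF this, of j "2*k+1"]
    have "I \<subseteq> left_half J \<or> I \<inter> left_half J = {}" "I \<subseteq> right_half J \<or> I \<inter> right_half J = {}"
      by (simp_all add: IJ left_half_dyad right_half_dyad)
    then show ?thesis using dyadic_halves[OF assms(2)] assms(3) by blast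
  qed
qed

text \<open>The dyadic intervals below \<open>J\<close> form a binary tree. Repeated halving makes an interval shorter
  than all members of the finite family \<open>F\<close>, and then it contains none of them; induction starts
  at these leaves and goes up to \<open>J\<close>.\<close>

lemma dyadic_induct [consumes 3, case_names leaf node]:
  assumes F: "finite F" "F \<subseteq> dyadic" and "J \<in> dyadic"
    and leaf: "\<And>J. J \<in> dyadic \<Longrightarrow> {I\<in>F. I \<subseteq> J} = {} \<Longrightarrow> P J"
    and node: "\<And>J. J \<in> dyadic \<Longrightarrow> P (left_half J) \<Longrightarrow> P (right_half J) \<Longrightarrow> P J"
  shows "P J"
proof (cases "F = {}")
  case True
  then show ?thesis using leaf \<open>J \<in> dyadic\<close> by simp
next
  case False
  define m where "m = Min (measure lebesgue ` F)"
  have "m > 0" unfolding m_def using F False measure_dyadic_pos by (subst Min_gr_iff) auto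
  have m: "m \<le> measure lebesgue I" if "I \<in> F" for I
    unfolding m_def using F that by auto
  have *: "P J" if "J \<in> dyadic" "measure lebesgue J < 2 ^ n * m" for n J
    using that
  proof (induction n arbitrary: J)
    case 0
    have "I \<notin> F" if "I \<subseteq> J" for I
    proof
      assume "I \<in> F"
      then have "measure lebesgue I \<le> measure lebesgue J"
        using that F 0 by (intro measure_mono_fmeasurable dyadic_fmeasurable) auto
      then show False using m[OF \<open>I \<in> F\<close>] 0 by simp
    qed
    then show ?case using 0 by (intro leaf) auto
  next
    case (Suc n)
    have "P (left_half J)" "P (right_half J)"
      by (rule Suc.IH; use Suc.prems in \<open>simp add: measure_half\<close>)+
    then show ?case using node Suc.prems by blast
  qed
  obtain n where "measure lebesgue J / m < 2 ^ n"
    using real_arch_pow[of 2] by auto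
  then have "measure lebesgue J < 2 ^ n * m"
    using \<open>m > 0\<close> by (simp add: field_simps)
  then show ?thesis using * \<open>J \<in> dyadic\<close> by blast
qed

lemma haar_left: "J \<in> dyadic \<Longrightarrow> t \<in> left_half J \<Longrightarrow> haar J t = -1"
  using dyadic_halves by (auto simp: haar_def indicator_def)

lemma haar_right: "J \<in> dyadic \<Longrightarrow> t \<in> right_half J \<Longrightarrow> haar J t = 1"
  using dyadic_halves by (auto simp: haar_def indicator_def)

lemma haar_outside: "J \<in> dyadic \<Longrightarrow> t \<notin> J \<Longrightarrow> haar J t = 0"
  using dyadic_halves(1)[of J] by (auto simp: haar_def indicator_def)

lemma haar_squared: "J \<in> dyadic \<Longrightarrow> (haar J t)\<^sup>2 = indicator J t"
  using dyadic_halves(1)[of J] haar_left[of J t] haar_right[of J t] haar_outside[of J t]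
  by (cases "t \<in> J"; simp) (metis UnE power2_minus power_one)

lemma haar_abs_le_1: "J \<in> dyadic \<Longrightarrow> \<bar>haar J t\<bar> \<le> 1"
  using haar_squared[of J t] by (auto simp: abs_le_square_iff simp flip: abs_square_le_1)

lemma haar_measurable [measurable]: "haar J \<in> borel_measurable lebesgue"
  unfolding haar_def[abs_def] left_half_def right_half_def
  by (intro borel_measurable_add borel_measurable_uminus borel_measurable_indicator) auto

section \<open>The energy of a partial Haar series on a dyadic interval\<close>

text \<open>The sum over the intervals inside \<open>J\<close> is the part of the series that varies on \<open>J\<close>; the
  intervals that strictly contain \<open>J\<close> together contribute a constant, which is the number \<open>x\<close>.\<close>

definition energy :: "real set \<Rightarrow> real set set \<Rightarrow> (real set \<Rightarrow> real) \<Rightarrow> real set \<Rightarrow> real \<Rightarrow> real" where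
  "energy E F a J x =
     (LINT t:J \<inter> E|lebesgue. (x + (\<Sum>I | I \<in> F \<and> I \<subseteq> J. a I * haar I t))\<^sup>2)"

lemma set_integrable_haar_sum_square:
  assumes "A \<in> lmeasurable" "F \<subseteq> dyadic"
  shows "set_integrable lebesgue A (\<lambda>t. (x + (\<Sum>I\<in>F. a I * haar I t))\<^sup>2)"
proof -
  define M where "M = \<bar>x\<bar> + (\<Sum>I\<in>F. \<bar>a I\<bar>)"
  have "\<bar>a I * haar I t\<bar> \<le> \<bar>a I\<bar>" if "I \<in> F" for I t
    using haar_abs_le_1[of I t] assms that by (auto simp: abs_mult mult_left_le)
  then have "\<bar>x + (\<Sum>I\<in>F. a I * haar I t)\<bar> \<le> M" for t
    unfolding M_def
    by (intro order_trans[OF abs_triangle_ineq] add_left_mono order_trans[OF sum_abs] sum_mono) auto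
  then have bound: "(x + (\<Sum>I\<in>F. a I * haar I t))\<^sup>2 \<le> M\<^sup>2" for t
    by (metis abs_ge_zero power2_abs power_mono)
  have "set_integrable lebesgue A (\<lambda>t. M\<^sup>2)"
    unfolding set_integrable_def using assms by (intro integrable_scaleR_left) (auto simp: fmeasurable_def)
  then show ?thesis
    unfolding set_integrable_def
    by (rule Bochner_Integration.integrable_bound) (use assms bound in \<open>auto simp: indicator_def\<close>)
qed

lemma sum_dyadic_split:
  assumes F: "finite F" "F \<subseteq> dyadic" and J: "J \<in> dyadic"
  shows "(\<Sum>I | I \<in> F \<and> I \<subseteq> J. g I :: real) = (if J \<in> F then g J else 0)
    + (\<Sum>I | I \<in> F \<and> I \<subseteq> left_half J. g I) + (\<Sum>I | I \<in> F \<and> I \<subseteq> right_half J. g I)"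
proof -
  define G where "G K = {I. I \<in> F \<and> I \<subseteq> K}" for K
  note h = dyadic_halves[OF J]
  have fin: "finite (G K)" for K
    unfolding G_def using F by auto
  have G: "G J = (F \<inter> {J}) \<union> (G (left_half J) \<union> G (right_half J))"
    unfolding G_def using dyadic_subset_cases[OF _ J] F h by blast
  have LR: "G (left_half J) \<inter> G (right_half J) = {}"
    unfolding G_def using dyadic_nonempty F h(2) by blast
  have J': "F \<inter> {J} \<inter> (G (left_half J) \<union> G (right_half J)) = {}"
    unfolding G_def
    using h dyadic_nonempty[OF half_dyadic(1)[OF J]] dyadic_nonempty[OF half_dyadic(2)[OF J]] by blast
  have "sum g (G J) = sum g (F \<inter> {J}) + (sum g (G (left_half J)) + sum g (G (right_half J)))"
    unfolding G using F fin LR J' by (simp add: sum.union_disjoint)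
  then show ?thesis by (simp add: G_def)
qed

text \<open>On the two halves of \<open>J\<close> the Haar function of \<open>J\<close> is \<open>-1\<close> and \<open>1\<close>, so it moves the constant \<open>x\<close>
  to \<open>x - b\<close> and \<open>x + b\<close>.\<close>

lemma energy_split:
  assumes E: "E \<in> sets lebesgue" and F: "finite F" "F \<subseteq> dyadic" and J: "J \<in> dyadic"
    and b: "b = (if J \<in> F then a J else 0)"
  shows "energy E F a J x = energy E F a (left_half J) (x - b) + energy E F a (right_half J) (x + b)"
proof -
  define S where "S K t = (\<Sum>I | I \<in> F \<and> I \<subseteq> K. a I * haar I t)" for K t
  note h = dyadic_halves[OF J]
  have sum: "S J t = b * haar J t + S (left_half J) t + S (right_half J) t" for t
    unfolding S_def b by (subst sum_dyadic_split[OF F J]) simp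
  have out: "S K t = 0" if "t \<notin> K" for K t
    unfolding S_def using that F haar_outside by (intro sum.neutral) fastforce
  have L: "x + S J t = (x - b) + S (left_half J) t" if "t \<in> left_half J" for t
    using that h out[of t "right_half J"] haar_left[OF J that] by (auto simp: sum)
  have R: "x + S J t = (x + b) + S (right_half J) t" if "t \<in> right_half J" for t
    using that h out[of t "left_half J"] haar_right[OF J that] by (auto simp: sum)
  have fm: "K \<inter> E \<in> lmeasurable" if "K \<in> dyadic" for K
    using E dyadic_fmeasurable[OF that] by (intro fmeasurable_Int_fmeasurable)
  have int: "set_integrable lebesgue (K \<inter> E) (\<lambda>t. (x + S J t)\<^sup>2)" if "K \<in> dyadic" for K
    unfolding S_def using fm[OF that] F by (intro set_integrable_haar_sum_square) auto
  have JE: "J \<inter> E = (left_half J \<inter> E) \<union> (right_half J \<inter> E)" using h by blast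
  have "energy E F a J x = (LINT t:(left_half J \<inter> E) \<union> (right_half J \<inter> E)|lebesgue. (x + S J t)\<^sup>2)"
    unfolding energy_def S_def[symmetric] JE ..
  also have "\<dots> = (LINT t:left_half J \<inter> E|lebesgue. (x + S J t)\<^sup>2) + (LINT t:right_half J \<inter> E|lebesgue. (x + S J t)\<^sup>2)"
    using h J by (intro set_integral_Un int) auto
  also have "(LINT t:left_half J \<inter> E|lebesgue. (x + S J t)\<^sup>2) = energy E F a (left_half J) (x - b)"
    unfolding energy_def S_def[symmetric]
    using E J by (intro set_lebesgue_integral_cong) (auto simp: L)
  also have "(LINT t:right_half J \<inter> E|lebesgue. (x + S J t)\<^sup>2) = energy E F a (right_half J) (x + b)"
    unfolding energy_def S_def[symmetric]
    using E J by (intro set_lebesgue_integral_cong) (auto simp: R)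
  finally show ?thesis .
qed

lemma energy_leaf:
  assumes E: "E \<in> sets lebesgue" and J: "J \<in> dyadic" and e: "{I\<in>F. I \<subseteq> J} = {}"
  shows "energy E F a J x = measure lebesgue (J \<inter> E) * x\<^sup>2"
proof -
  have fm: "J \<inter> E \<in> lmeasurable"
    using E dyadic_fmeasurable[OF J] by (intro fmeasurable_Int_fmeasurable)
  have e': "{I. I \<in> F \<and> I \<subseteq> J} = {}" using e by simp
  show ?thesis unfolding energy_def e' set_lebesgue_integral_def using fm
    by (simp add: fmeasurable_def)
qed

text \<open>Orthogonality of the Haar system. It gives the upper bound for the partial sums, from which
  the convergence of the series follows.\<close>

lemma energy_whole_line:
  assumes F: "finite F" "F \<subseteq> dyadic" and J: "J \<in> dyadic"
  shows "energy UNIV F a J x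
    = measure lebesgue J * x\<^sup>2 + (\<Sum>I | I \<in> F \<and> I \<subseteq> J. (a I)\<^sup>2 * measure lebesgue I)"
  using F J
proof (induction arbitrary: x rule: dyadic_induct)
  case (leaf J)
  then have e: "{I. I \<in> F \<and> I \<subseteq> J} = {}" by simp
  have "energy UNIV F a J x = measure lebesgue (J \<inter> UNIV) * x\<^sup>2"
    using leaf by (intro energy_leaf) auto
  then show ?case unfolding e by simp
next
  case (node J)
  show ?case
    unfolding energy_split[where a = a and E = UNIV, OF _ F node(1) refl, simplified] node.IH
    by (subst sum_dyadic_split[OF F node(1)])
      (simp add: measure_half[OF node(1)] power2_eq_square field_simps)
qed

section \<open>The Bellman function\<close>

text \<open>The infimum of the energy on an interval \<open>J\<close> over all coefficients is a multiple of \<open>x\<^sup>2\<close>; this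
  function bounds the factor from below, up to scaling, in terms of the density \<open>t\<close> of \<open>E\<close> in \<open>J\<close>.
  Below density \<open>p\<close> the coefficient of \<open>J\<close> vanishes, so the energy of \<open>J\<close> is the sum of those of its
  halves and an affine function is suitable. From density \<open>p\<close> on, the coefficient is free. If \<open>u\<close> and
  \<open>v\<close> are the factors on the halves, then the choice of \<open>b\<close> that minimizes
  \<open>(u * (x - b)\<^sup>2 + v * (x + b)\<^sup>2) / 2\<close> gives their harmonic mean times \<open>x\<^sup>2\<close>, so that the reciprocal of an
  affine function is suitable. The two branches agree at \<open>p\<close> and at \<open>2 * p - 1\<close>, the smallest
  density of a half of an interval of density \<open>p\<close>. These two conditions leave a one-parameter family;
  the zero \<open>(3 * p - 2) / 2\<close> of the affine branch is put half way between \<open>0\<close> and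
  \<open>3 * p - 2\<close>, for which the second branch would be infinite at density \<open>1\<close>.\<close>

definition bellman :: "real \<Rightarrow> real \<Rightarrow> real" where
  "bellman p t = (if t \<le> p then t - (3 * p - 2) / 2 else p * (2 - p) / (6 * p - 4 * t))"

text \<open>The sign of the last product tells which of the two branches is larger: the affine one between
  \<open>2 * p - 1\<close> and \<open>p\<close>, the other one above \<open>p\<close>.\<close>

lemma bellman_quadratic:
  "(6 * p - 4 * t) * (t - (3 * p - 2) / 2) = p * (2 - p) + 4 * (p - t) * (t - (2 * p - 1))" for p t :: real
  by (simp add: field_simps power2_eq_square)

lemma bellman_ge_affine:
  assumes "2 / 3 < p" "p \<le> 1" "t \<le> 1"
  shows "t - (3 * p - 2) / 2 \<le> bellman p t"
proof (cases "t \<le> p")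
  case False
  then have "(p - t) * (t - (2 * p - 1)) \<le> 0"
    using assms by (intro mult_nonpos_nonneg) auto
  then have "(6 * p - 4 * t) * (t - (3 * p - 2) / 2) \<le> p * (2 - p)"
    unfolding bellman_quadratic mult.assoc by simp
  then show ?thesis
    using False assms by (simp add: bellman_def pos_le_divide_eq mult.commute)
qed (simp add: bellman_def)

lemma bellman_ge_harmonic:
  assumes "2 / 3 < p" "p \<le> 1" "2 * p - 1 \<le> t" "t \<le> 1"
  shows "p * (2 - p) / (6 * p - 4 * t) \<le> bellman p t"
proof (cases "t \<le> p")
  case True
  then have "(p - t) * (t - (2 * p - 1)) \<ge> 0"
    using assms by (intro mult_nonneg_nonneg) auto
  then have "(6 * p - 4 * t) * (t - (3 * p - 2) / 2) \<ge> p * (2 - p)"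
    unfolding bellman_quadratic mult.assoc by simp
  then show ?thesis
    using True assms by (simp add: bellman_def pos_divide_le_eq mult.commute)
qed (simp add: bellman_def)

text \<open>The boundary condition. On an interval that carries no coefficient the energy is \<open>t * x\<^sup>2\<close> per
  unit of length, and it has to cover both the multiple of the Bellman function and the square that
  becomes the constant in the theorem.\<close>

lemma bellman_le:
  assumes "2 / 3 < p" "p \<le> 1" "0 \<le> t" "t \<le> 1"
  shows "((3 * p - 2) / 2)\<^sup>2 + (3 * p - 2) / 2 * bellman p t \<le> t"
proof (cases "t \<le> p")
  case True
  have "(3 * p - 2) / 2 * t \<le> 1 * t"
    using assms by (intro mult_right_mono) auto
  then show ?thesis using True by (simp add: bellman_def power2_eq_square algebra_simps)
next
  case False
  have "bellman p t \<le> p * (2 - p) / (6 * p - 4)"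
    using False assms by (simp add: bellman_def) (intro divide_left_mono; simp)
  then have "(3 * p - 2) / 2 * bellman p t \<le> (3 * p - 2) / 2 * (p * (2 - p) / (6 * p - 4))"
    using assms by (intro mult_left_mono) auto
  also have "\<dots> = p * (2 - p) / 4"
    using assms by (simp add: field_simps)
  also have "p * (2 - p) / 4 \<le> p * (4 / 3) / 4"
    using assms by (intro divide_right_mono mult_left_mono) auto
  finally have "(3 * p - 2) / 2 * bellman p t \<le> p / 3" by simp
  moreover have "((3 * p - 2) / 2)\<^sup>2 \<le> (1 / 2)\<^sup>2"
    using assms by (intro power_mono) auto
  ultimately show ?thesis using False assms by (simp add: power2_eq_square)
qed

text \<open>The minimum of the right-hand side over \<open>b\<close>.\<close>

lemma harmonic_split:
  fixes A B x b :: real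
  assumes "0 < A" "0 < B"
  shows "(2 * x)\<^sup>2 / (A + B) \<le> (x - b)\<^sup>2 / A + (x + b)\<^sup>2 / B"
proof -
  have "(x - b)\<^sup>2 / A + (x + b)\<^sup>2 / B - (2 * x)\<^sup>2 / (A + B)
      = (B * (x - b) - A * (x + b))\<^sup>2 / (A * B * (A + B))"
    using assms by (simp add: divide_simps) (simp add: power2_eq_square algebra_simps)
  also have "\<dots> \<ge> 0" using assms by simp
  finally show ?thesis by simp
qed

text \<open>If the interval has density at least \<open>p\<close>, then both halves have density at least \<open>2 * p - 1\<close>, and
  the harmonic branch bounds the Bellman function from below there. Otherwise \<open>b = 0\<close>, and the
  affine branch bounds it from below everywhere.\<close>

lemma bellman_split:
  assumes p: "2 / 3 < p" "p \<le> 1" and t: "t1 \<le> 1" "t2 \<le> 1" "t = (t1 + t2) / 2"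
    and b: "b \<noteq> 0 \<Longrightarrow> p \<le> t"
  shows "bellman p t * x\<^sup>2 \<le> (bellman p t1 * (x - b)\<^sup>2 + bellman p t2 * (x + b)\<^sup>2) / 2"
proof (cases "p \<le> t")
  case True
  define A B where "A = 6 * p - 4 * t1" and "B = 6 * p - 4 * t2"
  have pos: "A > 0" "B > 0" using p t by (auto simp: A_def B_def)
  have "6 * p - 4 * t = (A + B) / 2" using t by (simp add: A_def B_def field_simps)
  moreover have "bellman p t = p * (2 - p) / (6 * p - 4 * t)"
    using True p by (auto simp: bellman_def field_simps)
  ultimately have "bellman p t = p * (2 - p) / ((A + B) / 2)"
    by (simp only:)
  then have "bellman p t * x\<^sup>2 = p * (2 - p) / 2 * ((2 * x)\<^sup>2 / (A + B))"
    by (simp add: power_mult_distrib)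
  also have "\<dots> \<le> p * (2 - p) / 2 * ((x - b)\<^sup>2 / A + (x + b)\<^sup>2 / B)"
    using pos p by (intro mult_left_mono harmonic_split) auto
  also have "\<dots> = (p * (2 - p) / A * (x - b)\<^sup>2 + p * (2 - p) / B * (x + b)\<^sup>2) / 2"
    by (simp add: field_simps)
  also have "\<dots> \<le> (bellman p t1 * (x - b)\<^sup>2 + bellman p t2 * (x + b)\<^sup>2) / 2"
    unfolding A_def B_def using True p t
    by (intro divide_right_mono add_mono mult_right_mono bellman_ge_harmonic) auto
  finally show ?thesis .
next
  case False
  then have "b = 0" using b by auto
  have "bellman p t = ((t1 - (3 * p - 2) / 2) + (t2 - (3 * p - 2) / 2)) / 2"
    using False t by (simp add: bellman_def field_simps)
  also have "\<dots> \<le> (bellman p t1 + bellman p t2) / 2"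
    using p t by (intro divide_right_mono add_mono bellman_ge_affine) auto
  finally have "bellman p t * x\<^sup>2 \<le> (bellman p t1 + bellman p t2) / 2 * x\<^sup>2"
    by (intro mult_right_mono) auto
  then show ?thesis using \<open>b = 0\<close> by (simp add: field_simps)
qed

section \<open>The lower bound for finite sums\<close>

lemma measure_Int_halves:
  assumes E: "E \<in> sets lebesgue" and J: "J \<in> dyadic"
  shows "measure lebesgue (J \<inter> E) = measure lebesgue (left_half J \<inter> E) + measure lebesgue (right_half J \<inter> E)"
proof -
  have fm: "K \<inter> E \<in> lmeasurable" if "K \<in> dyadic" for K
    using E dyadic_fmeasurable[OF that] by (intro fmeasurable_Int_fmeasurable)
  have "J \<inter> E = (left_half J \<inter> E) \<union> (right_half J \<inter> E)"
    using dyadic_halves[OF J] by blast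
  moreover have "(left_half J \<inter> E) \<inter> (right_half J \<inter> E) = {}"
    using dyadic_halves(2)[OF J] by blast
  ultimately show ?thesis
    using measure_Un3[OF fm[OF half_dyadic(1)[OF J]] fm[OF half_dyadic(2)[OF J]]] by simp
qed

definition density :: "real set \<Rightarrow> real set \<Rightarrow> real" where
  "density E J = measure lebesgue (J \<inter> E) / measure lebesgue J"

lemma density_bounds:
  assumes E: "E \<in> sets lebesgue" and J: "J \<in> dyadic"
  shows "0 \<le> density E J" "density E J \<le> 1"
proof -
  have "measure lebesgue (J \<inter> E) \<le> measure lebesgue J"
    using E J by (intro measure_mono_fmeasurable dyadic_fmeasurable) auto
  then show "0 \<le> density E J" "density E J \<le> 1"
    using measure_dyadic_pos[OF J] by (auto simp: density_def)
qed

text \<open>The term with \<open>d\<^sup>2\<close> is \<open>d\<^sup>2\<close> times the energy on the whole of \<open>J\<close> (\<open>energy_whole_line\<close>). Thus the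
  lemma says that the integral over \<open>J\<close> of the square of \<open>x\<close> plus the sum, with weight
  \<open>indicator E - d\<^sup>2\<close>, is at least the multiple \<open>d * bellman p\<close> of \<open>x\<^sup>2\<close> times the length. Since the whole
  energy is additive over the halves in the same way as the energy on \<open>E\<close>, the sum of the squared
  coefficients needs no separate estimate in the induction step.\<close>

lemma energy_lower_bound:
  assumes p: "2 / 3 < p" "p \<le> 1" and E: "E \<in> sets lebesgue"
    and F: "finite F" "F \<subseteq> dyadic" and J: "J \<in> dyadic"
    and a: "\<And>I. I \<in> F \<Longrightarrow> a I \<noteq> 0 \<Longrightarrow> p \<le> density E I"
    and d: "d = (3 * p - 2) / 2"
  shows "d\<^sup>2 * (measure lebesgue J * x\<^sup>2 + (\<Sum>I | I \<in> F \<and> I \<subseteq> J. (a I)\<^sup>2 * measure lebesgue I))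
      + d * bellman p (density E J) * measure lebesgue J * x\<^sup>2 \<le> energy E F a J x"
  using F J
proof (induction arbitrary: x rule: dyadic_induct)
  case (leaf J)
  note m = measure_dyadic_pos[OF leaf(1)]
  have e: "{I. I \<in> F \<and> I \<subseteq> J} = {}" using leaf by simp
  have "d\<^sup>2 + d * bellman p (density E J) \<le> density E J"
    unfolding d using density_bounds[OF E leaf(1)] p by (intro bellman_le) auto
  then have "(d\<^sup>2 + d * bellman p (density E J)) * (measure lebesgue J * x\<^sup>2)
      \<le> density E J * (measure lebesgue J * x\<^sup>2)"
    using m by (intro mult_right_mono) auto
  then show ?case
    unfolding e energy_leaf[OF E leaf] using m by (simp add: density_def algebra_simps)
next
  case (node J)
  define b where "b = (if J \<in> F then a J else 0)"
  define L where "L = measure lebesgue J"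
  define t where "t K = density E K" for K
  define W where "W K = (\<Sum>I | I \<in> F \<and> I \<subseteq> K. (a I)\<^sup>2 * measure lebesgue I)" for K
  have "L > 0" unfolding L_def by (rule measure_dyadic_pos[OF node(1)])
  have W: "W J = b\<^sup>2 * L + W (left_half J) + W (right_half J)"
    unfolding W_def b_def L_def by (subst sum_dyadic_split[OF F node(1)]) simp
  have "bellman p (t J) * x\<^sup>2
      \<le> (bellman p (t (left_half J)) * (x - b)\<^sup>2 + bellman p (t (right_half J)) * (x + b)\<^sup>2) / 2"
    using p
  proof (rule bellman_split)
    show "t J = (t (left_half J) + t (right_half J)) / 2"
      using measure_dyadic_pos[OF node(1)]
      by (simp add: t_def density_def measure_half[OF node(1)] measure_Int_halves[OF E node(1)] field_simps)
  qed (use density_bounds[OF E] node(1) a in \<open>auto simp: t_def b_def split: if_splits\<close>)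
  then have "d * L * (bellman p (t J) * x\<^sup>2)
      \<le> d * L * ((bellman p (t (left_half J)) * (x - b)\<^sup>2 + bellman p (t (right_half J)) * (x + b)\<^sup>2) / 2)"
    using p \<open>L > 0\<close> by (intro mult_left_mono) (auto simp: d)
  then have "d\<^sup>2 * (L * x\<^sup>2 + W J) + d * bellman p (t J) * L * x\<^sup>2
      \<le> (d\<^sup>2 * (L / 2 * (x - b)\<^sup>2 + W (left_half J)) + d * bellman p (t (left_half J)) * (L / 2) * (x - b)\<^sup>2)
       + (d\<^sup>2 * (L / 2 * (x + b)\<^sup>2 + W (right_half J)) + d * bellman p (t (right_half J)) * (L / 2) * (x + b)\<^sup>2)"
    unfolding W by (simp add: field_simps power2_eq_square)
  also have "\<dots> \<le> energy E F a (left_half J) (x - b) + energy E F a (right_half J) (x + b)"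
    using node.IH[of "x - b"] node.IH(2)[of "x + b"] unfolding measure_half[OF node(1)] W_def t_def L_def
    by (intro add_mono)
  also have "\<dots> = energy E F a J x"
    by (rule energy_split[where a = a, OF E F node(1) b_def, symmetric])
  finally show ?case unfolding L_def W_def t_def .
qed

section \<open>Square integrable functions\<close>

lemma square_integrable_mult:
  assumes "square_integrable f" "square_integrable g"
  shows "integrable lebesgue (\<lambda>x. f x * g x)"
proof (rule Bochner_Integration.integrable_bound)
  show "integrable lebesgue (\<lambda>x. (f x)\<^sup>2 + (g x)\<^sup>2)"
    using assms by (auto simp: square_integrable_def)
  show "(\<lambda>x. f x * g x) \<in> borel_measurable lebesgue"
    using assms by (auto simp: square_integrable_def)
  have "\<bar>f x * g x\<bar> \<le> (f x)\<^sup>2 + (g x)\<^sup>2" for x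
    using zero_le_power2[of "\<bar>f x\<bar> - \<bar>g x\<bar>"] zero_le_power2[of "f x"] zero_le_power2[of "g x"]
    unfolding power2_diff abs_mult power2_abs by linarith
  then show "AE x in lebesgue. norm (f x * g x) \<le> norm ((f x)\<^sup>2 + (g x)\<^sup>2)"
    by simp
qed

lemma square_integrable_add:
  assumes "square_integrable f" "square_integrable g"
  shows "square_integrable (\<lambda>x. f x + g x)"
  using assms square_integrable_mult[OF assms]
  by (auto simp: square_integrable_def power2_sum mult.assoc)

lemma square_integrable_diff:
  assumes "square_integrable f" "square_integrable g"
  shows "square_integrable (\<lambda>x. f x - g x)"
  using assms square_integrable_mult[OF assms]
  by (auto simp: square_integrable_def power2_diff mult.assoc)

lemma square_integrable_sum:
  assumes "\<And>i. i \<in> F \<Longrightarrow> square_integrable (g i)"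
  shows "square_integrable (\<lambda>x. \<Sum>i\<in>F. g i x)"
  using assms
proof (induction F rule: infinite_finite_induct)
  case (insert i F)
  then show ?case by (simp add: square_integrable_add)
qed (auto simp: square_integrable_def)

lemma L2_norm_nonneg [simp]: "0 \<le> L2_norm f"
  by (simp add: L2_norm_def)

lemma L2_norm_square: "(L2_norm f)\<^sup>2 = (LINT x|lebesgue. (f x)\<^sup>2)"
  by (simp add: L2_norm_def)

text \<open>Cauchy-Schwarz and Minkowski, from the nonnegativity of the quadratic form
  \<open>\<integral>(s f + t g)\<^sup>2\<close> in \<open>s\<close> and \<open>t\<close>.\<close>

lemma L2_norm_triangle:
  assumes f: "square_integrable f" and g: "square_integrable g"
  shows "L2_norm (\<lambda>x. f x + g x) \<le> L2_norm f + L2_norm g"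
proof -
  have fg: "integrable lebesgue (\<lambda>x. f x * g x)" by (rule square_integrable_mult[OF f g])
  define P where "P = L2_norm f"
  define Q where "Q = L2_norm g"
  define R where "R = (LINT x|lebesgue. f x * g x)"
  have quad: "0 \<le> P\<^sup>2 * s\<^sup>2 + 2 * R * s * t + Q\<^sup>2 * t\<^sup>2" for s t
  proof -
    have "0 \<le> (LINT x|lebesgue. (s * f x + t * g x)\<^sup>2)" by simp
    also have "(\<lambda>x. (s * f x + t * g x)\<^sup>2)
        = (\<lambda>x. s\<^sup>2 * (f x)\<^sup>2 + 2 * s * t * (f x * g x) + t\<^sup>2 * (g x)\<^sup>2)"
      by (simp add: power2_eq_square algebra_simps)
    also have "(LINT x|lebesgue. s\<^sup>2 * (f x)\<^sup>2 + 2 * s * t * (f x * g x) + t\<^sup>2 * (g x)\<^sup>2)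
        = s\<^sup>2 * P\<^sup>2 + 2 * s * t * R + t\<^sup>2 * Q\<^sup>2"
      unfolding P_def Q_def R_def L2_norm_square
      using f g fg by (subst Bochner_Integration.integral_add)+ (auto simp: square_integrable_def)
    finally show ?thesis by (simp add: mult_ac)
  qed
  have "P \<ge> 0" "Q \<ge> 0" by (simp_all add: P_def Q_def)
  have "R \<le> P * Q"
  proof (cases "P = 0 \<or> Q = 0")
    case True
    show ?thesis
    proof (rule ccontr)
      assume "\<not> ?thesis"
      then have "R > 0" using True by auto
      define s where "s c = - (c + 1) / R" for c
      have s: "R * s c = - (c + 1)" for c
        using \<open>R > 0\<close> by (simp add: s_def)
      from True show False
      proof
        assume "P = 0"
        with quad[of "s (Q\<^sup>2)" 1] s[of "Q\<^sup>2"] have "Q\<^sup>2 + 2 \<le> 0" by (simp add: mult.assoc)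
        then show False using zero_le_power2[of Q] by linarith
      next
        assume "Q = 0"
        with quad[of 1 "s (P\<^sup>2)"] s[of "P\<^sup>2"] have "P\<^sup>2 + 2 \<le> 0" by (simp add: mult.assoc)
        then show False using zero_le_power2[of P] by linarith
      qed
    qed
  next
    case False
    then have "P * Q > 0" using \<open>P \<ge> 0\<close> \<open>Q \<ge> 0\<close> by simp
    have "0 \<le> 2 * (P * Q) * (P * Q - R)"
      using quad[of Q "-P"] by (simp add: power2_eq_square algebra_simps)
    then show ?thesis using \<open>P * Q > 0\<close> by (simp add: zero_le_mult_iff)
  qed
  have "(L2_norm (\<lambda>x. f x + g x))\<^sup>2 = P\<^sup>2 + 2 * R + Q\<^sup>2"
    unfolding P_def Q_def R_def L2_norm_square power2_sum
    using f g fg by (auto simp: square_integrable_def mult.assoc)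
  also have "\<dots> \<le> (P + Q)\<^sup>2"
    using \<open>R \<le> P * Q\<close> by (simp add: power2_sum)
  finally show ?thesis
    unfolding P_def Q_def by (rule power2_le_imp_le) simp
qed

lemma L2_norm_minus_commute: "L2_norm (\<lambda>x. f x - g x) = L2_norm (\<lambda>x. g x - f x)"
  by (simp add: L2_norm_def power2_commute)

text \<open>The weights \<open>2 ^ k\<close> make the weighted sum of the squared increments integrable, hence finite
  almost everywhere, and they still force the increments themselves to be summable there. The
  pointwise limit is the limit in \<open>L\<^sup>2\<close> by Fatou's lemma.\<close>

lemma L2_complete:
  fixes u :: "nat \<Rightarrow> real \<Rightarrow> real"
  assumes sq: "\<And>n. square_integrable (u n)"
    and Cauchy: "\<And>m n. n \<le> m \<Longrightarrow> (L2_norm (\<lambda>x. u m x - u n x))\<^sup>2 \<le> (1 / 4) ^ n"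
  shows "\<exists>f. square_integrable f \<and> (\<forall>n. (L2_norm (\<lambda>x. f x - u n x))\<^sup>2 \<le> (1 / 4) ^ n)"
proof -
  have [measurable]: "u n \<in> borel_measurable lebesgue" for n
    using sq by (simp add: square_integrable_def)
  have nn: "(\<integral>\<^sup>+x. ennreal ((u m x - u n x)\<^sup>2) \<partial>lebesgue) \<le> ennreal ((1 / 4) ^ n)" if "n \<le> m" for m n
  proof -
    have "(\<integral>\<^sup>+x. ennreal ((u m x - u n x)\<^sup>2) \<partial>lebesgue) = ennreal ((L2_norm (\<lambda>x. u m x - u n x))\<^sup>2)"
      unfolding L2_norm_square
      using square_integrable_diff[OF sq sq] by (intro nn_integral_eq_integral) (auto simp: square_integrable_def)
    then show ?thesis using Cauchy[OF that] by (simp add: ennreal_leI)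
  qed
  have "(\<integral>\<^sup>+x. (\<Sum>k. ennreal (2 ^ k * (u (Suc k) x - u k x)\<^sup>2)) \<partial>lebesgue)
      = (\<Sum>k. \<integral>\<^sup>+x. ennreal (2 ^ k * (u (Suc k) x - u k x)\<^sup>2) \<partial>lebesgue)"
    by (rule nn_integral_suminf) measurable
  also have "\<dots> \<le> (\<Sum>k. ennreal ((1 / 2) ^ k))"
  proof (intro suminf_le)
    fix k
    have "(\<integral>\<^sup>+x. ennreal (2 ^ k * (u (Suc k) x - u k x)\<^sup>2) \<partial>lebesgue)
        = ennreal (2 ^ k) * (\<integral>\<^sup>+x. ennreal ((u (Suc k) x - u k x)\<^sup>2) \<partial>lebesgue)"
      by (subst nn_integral_cmult[symmetric]) (auto simp: ennreal_mult)
    also have "\<dots> \<le> ennreal (2 ^ k) * ennreal ((1 / 4) ^ k)"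
      by (intro mult_left_mono nn) auto
    also have "\<dots> = ennreal ((1 / 2) ^ k)"
      by (simp flip: ennreal_mult power_mult_distrib)
    finally show "(\<integral>\<^sup>+x. ennreal (2 ^ k * (u (Suc k) x - u k x)\<^sup>2) \<partial>lebesgue) \<le> ennreal ((1 / 2) ^ k)" .
  qed auto
  also have "\<dots> = ennreal (\<Sum>k. (1 / 2) ^ k)"
    by (intro suminf_ennreal2) auto
  finally have fin: "(\<integral>\<^sup>+x. (\<Sum>k. ennreal (2 ^ k * (u (Suc k) x - u k x)\<^sup>2)) \<partial>lebesgue) < top"
    using le_less_trans by fastforce
  have "AE x in lebesgue. (\<Sum>k. ennreal (2 ^ k * (u (Suc k) x - u k x)\<^sup>2)) \<noteq> \<infinity>"
    by (rule nn_integral_noteq_infinite) (use fin in auto)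
  then have conv: "AE x in lebesgue. convergent (\<lambda>n. u n x)"
  proof eventually_elim
    case (elim x)
    then have "(\<Sum>k. ennreal (2 ^ k * (u (Suc k) x - u k x)\<^sup>2)) \<noteq> top" by simp
    then have "summable (\<lambda>k. 2 ^ k * (u (Suc k) x - u k x)\<^sup>2)"
      by (intro summable_suminf_not_top) auto
    then have sm: "summable (\<lambda>k. 2 ^ k * (u (Suc k) x - u k x)\<^sup>2 + (1 / 2) ^ k)"
      by (intro summable_add) auto
    have "summable (\<lambda>k. u (Suc k) x - u k x)"
    proof (rule summable_comparison_test'[OF sm])
      fix k
      \<comment> \<open>the inequality of the means for \<open>2 ^ k * y\<^sup>2\<close> and \<open>(1 / 2) ^ k\<close>, with \<open>y\<close> the increment\<close>
      define s where "s = sqrt (2 ^ k)"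
      have s: "s > 0" "s\<^sup>2 = 2 ^ k" by (simp_all add: s_def)
      have "0 \<le> (s * \<bar>u (Suc k) x - u k x\<bar> - 1 / s)\<^sup>2" by simp
      also have "\<dots> = 2 ^ k * (u (Suc k) x - u k x)\<^sup>2 + (1 / 2) ^ k - 2 * \<bar>u (Suc k) x - u k x\<bar>"
        using s by (simp add: power2_diff power_mult_distrib power_divide)
      finally have "2 * norm (u (Suc k) x - u k x) \<le> 2 ^ k * (u (Suc k) x - u k x)\<^sup>2 + (1 / 2) ^ k"
        by simp
      then show "norm (u (Suc k) x - u k x) \<le> 2 ^ k * (u (Suc k) x - u k x)\<^sup>2 + (1 / 2) ^ k"
        by (rule order_trans[rotated]) simp
    qed
    then have "convergent (\<lambda>n. u n x - u 0 x)"
      unfolding summable_iff_convergent sum_lessThan_telescope[of "\<lambda>k. u k x"] .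
    then have "convergent (\<lambda>n. (u n x - u 0 x) + u 0 x)"
      by (intro convergent_add convergent_const)
    then show ?case by simp
  qed
  define f where "f x = lim (\<lambda>n. u n x)" for x
  have [measurable]: "f \<in> borel_measurable lebesgue"
    unfolding f_def by measurable
  have lim: "AE x in lebesgue. (\<lambda>n. u n x) \<longlonglongrightarrow> f x"
    using conv by eventually_elim (auto simp: f_def convergent_LIMSEQ_iff)
  have est: "(\<integral>\<^sup>+x. ennreal ((f x - u n x)\<^sup>2) \<partial>lebesgue) \<le> ennreal ((1 / 4) ^ n)" for n
  proof -
    have "(\<integral>\<^sup>+x. ennreal ((f x - u n x)\<^sup>2) \<partial>lebesgue)
        \<le> (\<integral>\<^sup>+x. liminf (\<lambda>m. ennreal ((u m x - u n x)\<^sup>2)) \<partial>lebesgue)"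
    proof (rule nn_integral_mono_AE)
      show "AE x in lebesgue. ennreal ((f x - u n x)\<^sup>2) \<le> liminf (\<lambda>m. ennreal ((u m x - u n x)\<^sup>2))"
        using lim
      proof eventually_elim
        case (elim x)
        then have "(\<lambda>m. ennreal ((u m x - u n x)\<^sup>2)) \<longlonglongrightarrow> ennreal ((f x - u n x)\<^sup>2)"
          by (intro tendsto_intros)
        then show ?case by (intro eq_refl lim_imp_Liminf[symmetric] sequentially_bot)
      qed
    qed
    also have "\<dots> \<le> liminf (\<lambda>m. \<integral>\<^sup>+x. ennreal ((u m x - u n x)\<^sup>2) \<partial>lebesgue)"
      by (rule nn_integral_liminf) measurable
    also have "\<dots> \<le> ennreal ((1 / 4) ^ n)"
    proof (rule Liminf_le)
      show "\<forall>\<^sub>F m in sequentially. (\<integral>\<^sup>+x. ennreal ((u m x - u n x)\<^sup>2) \<partial>lebesgue) \<le> ennreal ((1 / 4) ^ n)"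
        using eventually_ge_at_top[of n] by eventually_elim (rule nn)
    qed simp
    finally show ?thesis .
  qed
  have int: "integrable lebesgue (\<lambda>x. (f x - u n x)\<^sup>2)" for n
    using est[of n] le_less_trans by (intro integrableI_bounded) fastforce+
  then have diff: "square_integrable (\<lambda>x. f x - u n x)" for n
    by (simp add: square_integrable_def)
  have "square_integrable f"
    using square_integrable_add[OF diff[of 0] sq[of 0]] by simp
  moreover have "(L2_norm (\<lambda>x. f x - u n x))\<^sup>2 \<le> (1 / 4) ^ n" for n
  proof -
    have "ennreal ((L2_norm (\<lambda>x. f x - u n x))\<^sup>2) = (\<integral>\<^sup>+x. ennreal ((f x - u n x)\<^sup>2) \<partial>lebesgue)"
      unfolding L2_norm_square using int by (intro nn_integral_eq_integral[symmetric]) auto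
    also have "\<dots> \<le> ennreal ((1 / 4) ^ n)" by (rule est)
    finally show ?thesis by (subst (asm) ennreal_le_iff) auto
  qed
  ultimately show ?thesis by blast
qed

text \<open>Partial sums over finite sets that avoid a large finite set are small, so the partial sums along a suitable increasing
  sequence of finite sets have a limit, and any larger finite set changes them by little.\<close>

lemma L2_has_sum_exists:
  assumes sq: "\<And>i. i \<in> A \<Longrightarrow> square_integrable (g i)"
    and summable: "b summable_on A" and b: "\<And>i. i \<in> A \<Longrightarrow> 0 \<le> b i"
    and bound: "\<And>F. finite F \<Longrightarrow> F \<subseteq> A \<Longrightarrow> (L2_norm (\<lambda>x. \<Sum>i\<in>F. g i x))\<^sup>2 \<le> sum b F"
  shows "\<exists>f. L2_has_sum g f A"
proof -
  have "\<exists>F. finite F \<and> F \<subseteq> A \<and> infsum b A - (1 / 4) ^ n < sum b F" for n :: nat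
  proof -
    have "(sum b \<longlongrightarrow> infsum b A) (finite_subsets_at_top A)"
      using has_sum_infsum[OF summable] by (simp add: has_sum_def)
    then have "\<forall>\<^sub>F F in finite_subsets_at_top A. infsum b A - (1 / 4) ^ n < sum b F"
      by (rule order_tendstoD) auto
    then show ?thesis
      unfolding eventually_finite_subsets_at_top by blast
  qed
  then obtain G where G: "\<And>n. finite (G n)" "\<And>n. G n \<subseteq> A" "\<And>n. infsum b A - (1 / 4) ^ n < sum b (G n)"
    by metis
  \<comment> \<open>an increasing sequence of finite sets outside which the terms \<open>b\<close> sum to less than \<open>(1 / 4) ^ n\<close>\<close>
  define H where "H n = (\<Union>k\<le>n. G k)" for n
  have H: "finite (H n)" "H n \<subseteq> A" "G n \<subseteq> H n" for n
    using G by (auto simp: H_def)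
  have H_mono: "H m \<subseteq> H n" if "m \<le> n" for m n
    unfolding H_def using that by (intro UN_mono) auto
  define S where "S F x = (\<Sum>i\<in>F. g i x)" for F x
  have sqS: "square_integrable (S F)" if "F \<subseteq> A" for F
    unfolding S_def using sq that by (intro square_integrable_sum) auto
  have tail: "(L2_norm (\<lambda>x. S F x - S (H n) x))\<^sup>2 \<le> (1 / 4) ^ n" if F: "finite F" "F \<subseteq> A" "H n \<subseteq> F" for F n
  proof -
    have "(\<lambda>x. S F x - S (H n) x) = (\<lambda>x. \<Sum>i\<in>F - H n. g i x)"
      unfolding S_def using F by (simp add: sum_diff)
    then have "(L2_norm (\<lambda>x. S F x - S (H n) x))\<^sup>2 \<le> sum b (F - H n)"
      using bound[of "F - H n"] F by auto
    also have "\<dots> \<le> sum b (F - G n)"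
      using H(3)[of n] F b by (intro sum_mono2) auto
    also have "\<dots> = sum b F - sum b (G n)"
      using F H(3)[of n] by (intro sum_diff) auto
    also have "\<dots> \<le> (1 / 4) ^ n"
      using finite_sum_le_infsum[OF summable F(1,2)] G(3)[of n] b by auto
    finally show ?thesis .
  qed
  have "\<exists>f. square_integrable f \<and> (\<forall>n. (L2_norm (\<lambda>x. f x - S (H n) x))\<^sup>2 \<le> (1 / 4) ^ n)"
    by (rule L2_complete) (use sqS H tail H_mono in auto)
  then obtain f where f: "square_integrable f" "\<And>n. (L2_norm (\<lambda>x. f x - S (H n) x))\<^sup>2 \<le> (1 / 4) ^ n"
    by blast
  have root: "L2_norm h \<le> (1 / 2) ^ n" if "(L2_norm h)\<^sup>2 \<le> (1 / 4) ^ n" for h n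
    using that by (intro power2_le_imp_le[of "L2_norm h"]) (auto simp: power2_eq_square simp flip: power_mult_distrib)
  have "((\<lambda>F. L2_norm (\<lambda>x. S F x - f x)) \<longlongrightarrow> 0) (finite_subsets_at_top A)"
  proof (rule tendstoI)
    fix e :: real assume "e > 0"
    then obtain n where n: "(1 / 2) ^ n < e / 2"
      using real_arch_pow_inv[of "e / 2" "1 / 2"] by auto
    have "\<forall>\<^sub>F F in finite_subsets_at_top A. finite F \<and> H n \<subseteq> F \<and> F \<subseteq> A"
      using H by (auto simp: eventually_finite_subsets_at_top intro!: exI[of _ "H n"])
    then show "\<forall>\<^sub>F F in finite_subsets_at_top A. dist (L2_norm (\<lambda>x. S F x - f x)) 0 < e"
    proof eventually_elim
      case (elim F)
      have "L2_norm (\<lambda>x. (S F x - S (H n) x) + (S (H n) x - f x))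
          \<le> L2_norm (\<lambda>x. S F x - S (H n) x) + L2_norm (\<lambda>x. S (H n) x - f x)"
        using elim H f by (intro L2_norm_triangle square_integrable_diff sqS) auto
      moreover have "L2_norm (\<lambda>x. S F x - S (H n) x) \<le> (1 / 2) ^ n"
        using tail elim by (intro root) auto
      moreover have "L2_norm (\<lambda>x. S (H n) x - f x) \<le> (1 / 2) ^ n"
        unfolding L2_norm_minus_commute[of "S (H n)"] using f by (intro root)
      ultimately show ?case using n by simp
    qed
  qed
  then have "L2_has_sum g f A"
    using sq f by (auto simp: L2_has_sum_def S_def)
  then show ?thesis by blast
qed

lemma L2_has_sum_norm_tendsto:
  assumes "L2_has_sum g f A"
  shows "((\<lambda>F. L2_norm (\<lambda>x. \<Sum>i\<in>F. g i x)) \<longlongrightarrow> L2_norm f) (finite_subsets_at_top A)"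
proof (rule LIM_zero_cancel, rule Lim_null_comparison)
  define S where "S F x = (\<Sum>i\<in>F. g i x)" for F x
  have f: "square_integrable f" and g: "\<And>i. i \<in> A \<Longrightarrow> square_integrable (g i)"
    and lim: "((\<lambda>F. L2_norm (\<lambda>x. S F x - f x)) \<longlongrightarrow> 0) (finite_subsets_at_top A)"
    using assms by (auto simp: L2_has_sum_def S_def)
  show "((\<lambda>F. L2_norm (\<lambda>x. (\<Sum>i\<in>F. g i x) - f x)) \<longlongrightarrow> 0) (finite_subsets_at_top A)"
    using lim by (simp add: S_def)
  have "\<forall>\<^sub>F F in finite_subsets_at_top A. F \<subseteq> A"
    by (auto simp: eventually_finite_subsets_at_top)
  then show "\<forall>\<^sub>F F in finite_subsets_at_top A. norm (L2_norm (\<lambda>x. \<Sum>i\<in>F. g i x) - L2_norm f)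
      \<le> L2_norm (\<lambda>x. (\<Sum>i\<in>F. g i x) - f x)"
  proof eventually_elim
    case (elim F)
    have S: "square_integrable (S F)"
      unfolding S_def using elim g by (intro square_integrable_sum) auto
    have "L2_norm (S F) \<le> L2_norm (\<lambda>x. S F x - f x) + L2_norm f"
      using L2_norm_triangle[OF square_integrable_diff[OF S f] f] by simp
    moreover have "L2_norm f \<le> L2_norm (\<lambda>x. S F x - f x) + L2_norm (S F)"
      using L2_norm_triangle[OF square_integrable_diff[OF f S] S]
      by (simp add: L2_norm_minus_commute[of f])
    ultimately show ?case by (simp add: S_def[abs_def] abs_le_iff)
  qed
qed

section \<open>Densities above two thirds\<close>

lemma unit_interval_dyad: "{0..<1} = dyad 0 0"
  by (simp add: dyad_def)

lemma unit_interval_dyadic: "{0..<1} \<in> dyadic"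
  unfolding unit_interval_dyad dyadic_iff by blast

lemma haar_term_square:
  assumes "I \<in> dyadic"
  shows "(haar_term E a I t)\<^sup>2 = (a I)\<^sup>2 * indicator (I \<inter> E) t"
  using haar_squared[OF assms, of t] by (auto simp: haar_term_def power_mult_distrib indicator_def)

lemma square_integrable_haar_term:
  assumes "E \<in> sets lebesgue" "I \<in> dyadic"
  shows "square_integrable (haar_term E a I)"
proof -
  have "I \<inter> E \<in> lmeasurable"
    using assms by (intro fmeasurable_Int_fmeasurable dyadic_fmeasurable)
  then have "integrable lebesgue (\<lambda>t. (haar_term E a I t)\<^sup>2)"
    unfolding haar_term_square[OF assms(2)]
    by (intro integrable_mult_right) (auto simp: fmeasurable_def)
  moreover have "haar_term E a I \<in> borel_measurable lebesgue"
    using assms unfolding haar_term_def by measurable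
  ultimately show ?thesis
    by (simp add: square_integrable_def)
qed

lemma L2_norm_haar_term:
  assumes "E \<in> sets lebesgue" "I \<in> dyadic"
  shows "(L2_norm (haar_term E a I))\<^sup>2 = (a I)\<^sup>2 * measure lebesgue (I \<inter> E)"
  unfolding L2_norm_square haar_term_square[OF assms(2)] using assms by simp

lemma L2_norm_haar_sum:
  assumes "E \<subseteq> {0..<1}" "finite F" "F \<subseteq> dyadic" "\<And>I. I \<in> F \<Longrightarrow> a I \<noteq> 0 \<Longrightarrow> I \<subseteq> {0..<1}"
  shows "(L2_norm (\<lambda>t. \<Sum>I\<in>F. haar_term E a I t))\<^sup>2 = energy E F a {0..<1} 0"
proof -
  have "(\<Sum>I\<in>F. haar_term E a I t)\<^sup>2
      = indicator ({0..<1} \<inter> E) t * (0 + (\<Sum>I | I \<in> F \<and> I \<subseteq> {0..<1}. a I * haar I t))\<^sup>2" for t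
  proof -
    have "(\<Sum>I\<in>F. haar_term E a I t) = (\<Sum>I | I \<in> F \<and> I \<subseteq> {0..<1}. haar_term E a I t)"
      using assms by (intro sum.mono_neutral_right) (auto simp: haar_term_def)
    also have "\<dots> = indicator ({0..<1} \<inter> E) t * (\<Sum>I | I \<in> F \<and> I \<subseteq> {0..<1}. a I * haar I t)"
      unfolding sum_distrib_left using assms(1) by (intro sum.cong) (auto simp: haar_term_def indicator_def)
    finally show ?thesis by (simp add: power_mult_distrib indicator_def)
  qed
  then show ?thesis
    by (simp add: L2_norm_square energy_def set_lebesgue_integral_def)
qed

lemma energy_mono:
  assumes "E \<in> sets lebesgue" "F \<subseteq> dyadic" "J \<in> dyadic"
  shows "energy E F a J x \<le> energy UNIV F a J x"
proof -
  have "J \<inter> E \<in> lmeasurable" "J \<inter> UNIV \<in> lmeasurable"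
    using assms dyadic_fmeasurable[OF assms(3)] by (auto intro!: fmeasurable_Int_fmeasurable)
  then have *: "set_integrable lebesgue (J \<inter> E) (\<lambda>t. (x + (\<Sum>I | I \<in> F \<and> I \<subseteq> J. a I * haar I t))\<^sup>2)"
    "set_integrable lebesgue (J \<inter> UNIV) (\<lambda>t. (x + (\<Sum>I | I \<in> F \<and> I \<subseteq> J. a I * haar I t))\<^sup>2)"
    using assms by (intro set_integrable_haar_sum_square; auto)+
  show ?thesis
    unfolding energy_def set_lebesgue_integral_def
    using * by (intro integral_mono) (auto simp: set_integrable_def indicator_def)
qed

text \<open>A dyadic interval that meets the unit interval without being part of it has length at least
  \<open>2\<close>, so \<open>E\<close> fills at most half of it.\<close>

lemma dense_imp_subset_unit_interval:
  assumes E: "E \<in> sets lebesgue" "E \<subseteq> {0..<1}" and I: "I \<in> dyadic" and d: "1 / 2 < density E I"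
  shows "I \<subseteq> {0..<1}"
proof -
  obtain n k where nk: "I = dyad n k" using I by (auto simp: dyadic_iff)
  have pos: "measure lebesgue (I \<inter> E) > 2 powi n / 2"
    using d by (simp add: density_def nk field_simps)
  have "measure lebesgue (I \<inter> E) \<le> measure lebesgue {0..<1::real}"
    using E I dyadic_fmeasurable[OF unit_interval_dyadic]
    by (intro measure_mono_fmeasurable) auto
  with pos have "(2::real) powi n < 2 powi 1" by simp
  then have "n \<le> 0"
    using power_int_increasing[of 1 n "2::real"] by (force simp: not_le[symmetric])
  moreover have "I \<inter> {0..<1} \<noteq> {}"
  proof
    assume "I \<inter> {0..<1} = {}"
    then have "I \<inter> E = {}" using E by blast
    then show False using pos measure_dyadic_pos[OF I] unfolding nk measure_dyad by simp
  qed
  ultimately show ?thesis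
    using dyad_nested[of n 0 k 0] by (simp add: nk unit_interval_dyad)
qed

text \<open>Both bounds are the case \<open>x = 0\<close> on the unit interval, where all nonzero terms live. The factor
  \<open>3 / 2\<close> compares the length of an interval with the measure of its intersection with \<open>E\<close>.\<close>

lemma haar_sum_norm_bounds:
  assumes p: "2 / 3 < p" "p \<le> 1" and adm: "admissible p E a"
    and F: "finite F" "F \<subseteq> dyadic"
  shows "((3 * p - 2) / 2)\<^sup>2 * (\<Sum>I\<in>F. (L2_norm (haar_term E a I))\<^sup>2)
      \<le> (L2_norm (\<lambda>t. \<Sum>I\<in>F. haar_term E a I t))\<^sup>2" (is "?lower")
    and "(L2_norm (\<lambda>t. \<Sum>I\<in>F. haar_term E a I t))\<^sup>2
      \<le> (\<Sum>I\<in>F. 3 / 2 * (L2_norm (haar_term E a I))\<^sup>2)" (is "?upper")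
proof -
  have E: "E \<in> sets lebesgue" "E \<subseteq> {0..<1}" using adm by (auto simp: admissible_def)
  have dense: "p \<le> density E I" if "I \<in> F" "a I \<noteq> 0" for I
  proof -
    have "I \<in> dyadic" using that F by auto
    then have "\<not> measure lebesgue (I \<inter> E) < p * measure lebesgue I"
      using adm that by (auto simp: admissible_def)
    then show ?thesis
      using measure_dyadic_pos[OF \<open>I \<in> dyadic\<close>] by (simp add: density_def pos_le_divide_eq)
  qed
  then have sub: "I \<subseteq> {0..<1}" if "I \<in> F" "a I \<noteq> 0" for I
    using dense_imp_subset_unit_interval[OF E, of I] dense[OF that] that F p by auto
  have total: "(\<Sum>I | I \<in> F \<and> I \<subseteq> {0..<1}. (a I)\<^sup>2 * measure lebesgue I) = (\<Sum>I\<in>F. (a I)\<^sup>2 * measure lebesgue I)"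
    using F sub by (intro sum.mono_neutral_left) auto
  have norm: "(L2_norm (\<lambda>t. \<Sum>I\<in>F. haar_term E a I t))\<^sup>2 = energy E F a {0..<1} 0"
    using E F sub by (intro L2_norm_haar_sum)
  have "((3 * p - 2) / 2)\<^sup>2 * (\<Sum>I\<in>F. (L2_norm (haar_term E a I))\<^sup>2)
      \<le> ((3 * p - 2) / 2)\<^sup>2 * (\<Sum>I\<in>F. (a I)\<^sup>2 * measure lebesgue I)"
  proof (intro mult_left_mono sum_mono)
    fix I assume "I \<in> F"
    then have I: "I \<in> dyadic" using F by auto
    show "(L2_norm (haar_term E a I))\<^sup>2 \<le> (a I)\<^sup>2 * measure lebesgue I"
      unfolding L2_norm_haar_term[OF E(1) I] using E I
      by (intro mult_left_mono measure_mono_fmeasurable dyadic_fmeasurable) auto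
  qed auto
  also have "\<dots> \<le> energy E F a {0..<1} 0"
    using energy_lower_bound[where a = a and x = 0, OF p E(1) F unit_interval_dyadic dense refl]
    by (simp add: total)
  finally show ?lower unfolding norm .
  have "energy E F a {0..<1} 0 \<le> energy UNIV F a {0..<1} 0"
    by (intro energy_mono E F unit_interval_dyadic)
  also have "\<dots> = (\<Sum>I\<in>F. (a I)\<^sup>2 * measure lebesgue I)"
    by (simp add: energy_whole_line[OF F unit_interval_dyadic] total)
  also have "\<dots> \<le> (\<Sum>I\<in>F. 3 / 2 * (L2_norm (haar_term E a I))\<^sup>2)"
  proof (intro sum_mono)
    fix I assume I: "I \<in> F"
    then have "I \<in> dyadic" using F by auto
    show "(a I)\<^sup>2 * measure lebesgue I \<le> 3 / 2 * (L2_norm (haar_term E a I))\<^sup>2"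
    proof (cases "a I = 0")
      case False
      then have "2 / 3 \<le> density E I" using dense[OF I] p by simp
      then have "measure lebesgue I \<le> 3 / 2 * measure lebesgue (I \<inter> E)"
        using measure_dyadic_pos[OF \<open>I \<in> dyadic\<close>] by (simp add: density_def field_simps)
      then have "(a I)\<^sup>2 * measure lebesgue I \<le> (a I)\<^sup>2 * (3 / 2 * measure lebesgue (I \<inter> E))"
        by (intro mult_left_mono) auto
      then show ?thesis using \<open>I \<in> dyadic\<close> E by (simp add: L2_norm_haar_term)
    qed simp
  qed
  finally show ?upper unfolding norm .
qed

lemma lower_bound_above_two_thirds:
  assumes p: "2 / 3 < p" "p \<le> 1" and adm: "admissible p E a"
    and summable: "(\<lambda>I. (L2_norm (haar_term E a I))\<^sup>2) summable_on dyadic"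
  shows "\<exists>f. L2_has_sum (haar_term E a) f dyadic"
    and "L2_has_sum (haar_term E a) f dyadic \<Longrightarrow>
      ((3 * p - 2) / 2)\<^sup>2 * (\<Sum>\<^sub>\<infinity>I\<in>dyadic. (L2_norm (haar_term E a I))\<^sup>2) \<le> (L2_norm f)\<^sup>2"
proof -
  have E: "E \<in> sets lebesgue" using adm by (simp add: admissible_def)
  show "\<exists>f. L2_has_sum (haar_term E a) f dyadic"
    by (rule L2_has_sum_exists[OF square_integrable_haar_term[OF E] summable_on_cmult_right[OF summable, of "3 / 2"]])
      (use haar_sum_norm_bounds(2)[OF p adm] in auto)
  assume f: "L2_has_sum (haar_term E a) f dyadic"
  show "((3 * p - 2) / 2)\<^sup>2 * (\<Sum>\<^sub>\<infinity>I\<in>dyadic. (L2_norm (haar_term E a I))\<^sup>2) \<le> (L2_norm f)\<^sup>2"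
  proof (rule tendsto_le)
    show "((\<lambda>F. (L2_norm (\<lambda>t. \<Sum>I\<in>F. haar_term E a I t))\<^sup>2) \<longlongrightarrow> (L2_norm f)\<^sup>2) (finite_subsets_at_top dyadic)"
      by (intro tendsto_power L2_has_sum_norm_tendsto f)
    show "((\<lambda>F. ((3 * p - 2) / 2)\<^sup>2 * (\<Sum>I\<in>F. (L2_norm (haar_term E a I))\<^sup>2))
        \<longlongrightarrow> ((3 * p - 2) / 2)\<^sup>2 * (\<Sum>\<^sub>\<infinity>I\<in>dyadic. (L2_norm (haar_term E a I))\<^sup>2)) (finite_subsets_at_top dyadic)"
      using has_sum_infsum[OF summable] by (intro tendsto_mult_left) (simp add: has_sum_def)
    show "\<forall>\<^sub>F F in finite_subsets_at_top dyadic. ((3 * p - 2) / 2)\<^sup>2 * (\<Sum>I\<in>F. (L2_norm (haar_term E a I))\<^sup>2)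
        \<le> (L2_norm (\<lambda>t. \<Sum>I\<in>F. haar_term E a I t))\<^sup>2"
      using haar_sum_norm_bounds(1)[OF p adm] by (auto simp: eventually_finite_subsets_at_top)
  qed simp
qed

section \<open>Densities up to two thirds\<close>

definition corner :: "nat \<Rightarrow> real set" where
  "corner k = {0 ..< (1 / 4) ^ k}"

text \<open>The union of the right halves of the intervals \<open>corner k\<close>. It is self-similar under scaling by
  \<open>1 / 4\<close>, so its density is the same in every corner, namely the solution \<open>2 / 3\<close> of
  \<open>t = 1 / 2 + t / 4\<close>.\<close>

definition witness_set :: "real set" where
  "witness_set = (\<Union>k. {(1 / 4) ^ k / 2 ..< (1 / 4) ^ k})"

lemma corner_dyad: "corner k = dyad (- 2 * int k) 0"
proof -
  have "(2::real) powi (- 2 * int k) = (2 powi (- 2)) powi int k"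
    by (rule power_int_mult)
  then have "(2::real) powi (- 2 * int k) = (1 / 4) ^ k"
    by (simp add: power_int_minus power_divide)
  then show ?thesis by (simp add: corner_def dyad_def)
qed

lemma corner_dyadic [simp]: "corner k \<in> dyadic"
  unfolding corner_dyad dyadic_iff by blast

lemma measure_corner: "measure lebesgue (corner k) = (1 / 4) ^ k"
  by (simp add: corner_def)

lemma inj_corner: "inj corner"
proof (rule injI)
  fix j k assume "corner j = corner k"
  then have "(1 / 4 :: real) ^ j = (1 / 4) ^ k" by (metis measure_corner)
  then show "j = k" by (simp add: power_divide)
qed

lemma halves_corner:
  "left_half (corner k) = {0 ..< (1 / 4) ^ k / 2}" "right_half (corner k) = {(1 / 4) ^ k / 2 ..< (1 / 4) ^ k}"
  by (simp_all add: left_half_def right_half_def corner_def)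

lemma quarter_power_le_half:
  assumes "j < m" shows "(1 / 4 :: real) ^ m \<le> (1 / 4) ^ j / 2"
proof -
  have "(1 / 4 :: real) ^ m \<le> (1 / 4) ^ Suc j"
    using assms by (intro power_decreasing) auto
  also have "\<dots> \<le> (1 / 4) ^ j / 2" by simp
  finally show ?thesis .
qed

lemma corner_Int_witness_set:
  "corner m \<inter> witness_set = (\<Union>k. {(1 / 4) ^ (k + m) / 2 ..< (1 / 4) ^ (k + m)})"
proof (intro equalityI subsetI)
  fix x assume "x \<in> corner m \<inter> witness_set"
  then obtain j where j: "x < (1 / 4) ^ m" "(1 / 4) ^ j / 2 \<le> x" "x < (1 / 4) ^ j"
    by (auto simp: corner_def witness_set_def)
  then have "\<not> j < m" using quarter_power_le_half[of j m] by auto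
  then have "j = (j - m) + m" by simp
  then show "x \<in> (\<Union>k. {(1 / 4) ^ (k + m) / 2 ..< (1 / 4) ^ (k + m)})"
    using j by (metis UN_I UNIV_I atLeastLessThan_iff)
next
  fix x :: real assume "x \<in> (\<Union>k. {(1 / 4) ^ (k + m) / 2 ..< (1 / 4) ^ (k + m)})"
  then obtain k where k: "(1 / 4) ^ (k + m) / 2 \<le> x" "x < (1 / 4) ^ (k + m)" by auto
  have "(1 / 4 :: real) ^ (k + m) \<le> (1 / 4) ^ m" by (intro power_decreasing) auto
  moreover have "0 \<le> x" using k(1) by (rule order_trans[rotated]) simp
  ultimately have "x \<in> corner m"
    using k(2) unfolding corner_def atLeastLessThan_iff by linarith
  then show "x \<in> corner m \<inter> witness_set"
    using k by (auto simp: witness_set_def)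
qed

lemma witness_set_measurable [measurable]: "witness_set \<in> sets lebesgue"
  unfolding witness_set_def by auto

lemma witness_set_subset: "witness_set \<subseteq> {0..<1}"
  using corner_Int_witness_set[of 0] by (auto simp: corner_def witness_set_def)

lemma measure_corner_witness_set: "measure lebesgue (corner m \<inter> witness_set) = 2 / 3 * (1 / 4) ^ m"
proof -
  define P where "P k = {(1 / 4) ^ (k + m) / 2 ..< (1 / 4 :: real) ^ (k + m)}" for k
  have "P i \<inter> P j = {}" if "i < j" for i j
    using quarter_power_le_half[of "i + m" "j + m"] that by (auto simp: P_def)
  then have "disjoint_family P"
    unfolding disjoint_family_on_def by (metis Int_commute nat_neq_iff)
  moreover have "corner m \<inter> witness_set \<in> lmeasurable"
    by (intro fmeasurable_Int_fmeasurable dyadic_fmeasurable) auto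
  then have "emeasure lebesgue (\<Union>k. P k) \<noteq> \<infinity>"
    by (simp add: corner_Int_witness_set P_def fmeasurable_def)
  moreover have "range P \<subseteq> sets lebesgue" by (auto simp: P_def)
  ultimately have "(\<lambda>k. measure lebesgue (P k)) sums measure lebesgue (\<Union>k. P k)"
    by (intro measure_UNION)
  moreover have "(\<lambda>k. measure lebesgue (P k)) = (\<lambda>k. (1 / 4) ^ m / 2 * (1 / 4) ^ k)"
    by (simp add: P_def power_add fun_eq_iff)
  moreover have "(\<lambda>k. (1 / 4) ^ m / 2 * (1 / 4 :: real) ^ k) sums ((1 / 4) ^ m / 2 * (1 / (1 - 1 / 4)))"
    by (intro sums_mult geometric_sums) auto
  ultimately have "measure lebesgue (\<Union>k. P k) = (1 / 4) ^ m / 2 * (1 / (1 - 1 / 4))"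
    using sums_unique2 by metis
  then show ?thesis by (simp add: corner_Int_witness_set P_def)
qed

text \<open>With the constant \<open>1\<close> added, the partial sum is \<open>2 ^ n\<close> on \<open>corner n\<close>, and the next term doubles
  that value on the left half and cancels it on the right half.\<close>

lemma corner_sum_values:
  shows "t \<in> corner n \<Longrightarrow> (\<Sum>k<n. - (2 ^ k) * haar (corner k) t) = 2 ^ n - 1"
    and "t \<in> right_half (corner j) \<Longrightarrow> j < n \<Longrightarrow> (\<Sum>k<n. - (2 ^ k) * haar (corner k) t) = - 1"
proof (induction n)
  case 0
  { case 1 show ?case by simp }
  { case 2 then show ?case by simp }
next
  case (Suc n)
  note sub = quarter_power_le_half[of n "Suc n"]
  { case 1
    then have "t \<in> left_half (corner n)" using sub by (auto simp: halves_corner) (auto simp: corner_def)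
    moreover from this have "t \<in> corner n" using dyadic_halves(1)[of "corner n"] by auto
    ultimately show ?case using Suc.IH(1) by (simp add: haar_left) }
  { case 2
    show ?case
    proof (cases "j = n")
      case True
      with 2 have "t \<in> right_half (corner n)" by simp
      moreover from this have "t \<in> corner n" using dyadic_halves(1)[of "corner n"] by auto
      ultimately show ?thesis using Suc.IH(1) by (simp add: haar_right)
    next
      case False
      with 2 have "j < n" by simp
      then have "t \<notin> corner n"
        using 2 quarter_power_le_half[of j n] unfolding halves_corner by (auto simp: corner_def)
      then show ?thesis using Suc.IH(2) 2 \<open>j < n\<close> by (simp add: haar_outside)
    qed }
qed

text \<open>The sum is \<open>-1\<close> on the witness set outside \<open>corner n\<close>, and on \<open>corner n\<close> the growth of its square
  is balanced by the decay of the length.\<close>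

lemma corner_sum_norm_le:
  "(LINT t|lebesgue. ((\<Sum>k<n. - (2 ^ k) * haar (corner k) t) * indicator witness_set t)\<^sup>2) \<le> 4 / 3"
proof -
  have fm: "corner k \<inter> witness_set \<in> lmeasurable" for k
    by (intro fmeasurable_Int_fmeasurable dyadic_fmeasurable) auto
  define B :: "real \<Rightarrow> real" where
    "B t = indicator (corner 0 \<inter> witness_set) t + 4 ^ n * indicator (corner n \<inter> witness_set) t" for t
  have B: "integrable lebesgue B"
    unfolding B_def using fm by (intro Bochner_Integration.integrable_add integrable_mult_right) (auto simp: fmeasurable_def)
  have "((\<Sum>k<n. - (2 ^ k) * haar (corner k) t) * indicator witness_set t)\<^sup>2 \<le> B t" for t
  proof (cases "t \<in> witness_set")
    case True
    then have 0: "t \<in> corner 0" using witness_set_subset by (auto simp: corner_def)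
    obtain j where j: "t \<in> right_half (corner j)"
      using True by (auto simp: witness_set_def halves_corner)
    show ?thesis
    proof (cases "j < n")
      case True
      show ?thesis
        unfolding corner_sum_values(2)[OF j True] using \<open>t \<in> witness_set\<close> 0 by (simp add: B_def)
    next
      case False
      then have "(1 / 4 :: real) ^ j \<le> (1 / 4) ^ n" by (intro power_decreasing) auto
      moreover have "t < (1 / 4) ^ j" using j unfolding halves_corner by simp
      moreover have "0 \<le> t" using 0 by (simp add: corner_def)
      ultimately have n: "t \<in> corner n" unfolding corner_def atLeastLessThan_iff by linarith
      have "(2 ^ n - 1)\<^sup>2 \<le> (2 ^ n :: real)\<^sup>2" by (intro power_mono) auto
      also have "\<dots> = 4 ^ n" by (simp add: power2_eq_square flip: power_mult_distrib)
      finally show ?thesis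
        unfolding corner_sum_values(1)[OF n] using \<open>t \<in> witness_set\<close> 0 n by (simp add: B_def)
    qed
  qed (simp add: B_def)
  then have "(LINT t|lebesgue. ((\<Sum>k<n. - (2 ^ k) * haar (corner k) t) * indicator witness_set t)\<^sup>2) \<le> integral\<^sup>L lebesgue B"
    by (intro integral_mono' B) (auto simp: B_def)
  also have "\<dots> = 2 / 3 + 4 ^ n * (2 / 3 * (1 / 4) ^ n)"
    unfolding B_def using fm
    by (subst Bochner_Integration.integral_add) (auto simp: fmeasurable_def measure_corner_witness_set)
  also have "\<dots> = 4 / 3" by (simp add: power_divide)
  finally show ?thesis .
qed

text \<open>Every one of the \<open>n\<close> terms has the same squared norm \<open>2 / 3\<close>, whereas the squared norm of their sum
  stays bounded.\<close>

lemma no_lower_bound_up_to_two_thirds: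
  fixes p c :: real
  assumes p: "p \<le> 2 / 3" and c: "0 < c"
  shows "\<exists>E a f. admissible p E a \<and> (\<lambda>I. (L2_norm (haar_term E a I))\<^sup>2) summable_on dyadic \<and>
    L2_has_sum (haar_term E a) f dyadic \<and>
    (L2_norm f)\<^sup>2 < c * (\<Sum>\<^sub>\<infinity>I\<in>dyadic. (L2_norm (haar_term E a I))\<^sup>2)"
proof -
  obtain n :: nat where n: "2 / c < n" using reals_Archimedean2 by blast
  define F where "F = corner ` {..<n}"
  define a where "a I = (if I \<in> F then - 1 / sqrt (measure lebesgue I) else 0)" for I
  define f where "f t = (\<Sum>I\<in>F. haar_term witness_set a I t)" for t
  have F: "finite F" "F \<subseteq> dyadic" by (auto simp: F_def)
  have a_corner: "a (corner k) = - (2 ^ k)" if "k < n" for k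
  proof -
    have "sqrt ((1 / 4) ^ k) = (1 / 2) ^ k"
      by (intro real_sqrt_unique) (simp_all add: power2_eq_square flip: power_mult_distrib)
    then show ?thesis using that by (simp add: a_def F_def measure_corner power_divide)
  qed
  have sum_F: "(\<Sum>I\<in>F. g I) = (\<Sum>k<n. g (corner k) :: real)" for g
    unfolding F_def using inj_corner by (subst sum.reindex) (auto intro: inj_on_subset)
  have zero: "haar_term witness_set a I = (\<lambda>t. 0)" if "I \<notin> F" for I
    using that by (simp add: haar_term_def a_def fun_eq_iff)
  have "admissible p witness_set a"
    unfolding admissible_def
  proof (intro conjI ballI impI)
    fix I assume I: "measure lebesgue (I \<inter> witness_set) < p * measure lebesgue I"
    have "I \<notin> F"
    proof
      assume "I \<in> F"
      then obtain k where "I = corner k" by (auto simp: F_def)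
      with I have "2 / 3 * (1 / 4) ^ k < p * (1 / 4) ^ k"
        by (simp add: measure_corner_witness_set measure_corner)
      then show False using p by (simp add: mult_less_cancel_right)
    qed
    then show "a I = 0" by (simp add: a_def)
  qed (use witness_set_subset in auto)
  moreover have sum: "((\<lambda>I. (L2_norm (haar_term witness_set a I))\<^sup>2) has_sum (2 * n / 3)) dyadic"
  proof (rule has_sum_finite_neutralI[OF F])
    have "(\<Sum>I\<in>F. (L2_norm (haar_term witness_set a I))\<^sup>2) = (\<Sum>k<n. 2 / 3)"
      unfolding sum_F
    proof (intro sum.cong refl)
      fix k assume "k \<in> {..<n}"
      then have "(L2_norm (haar_term witness_set a (corner k)))\<^sup>2 = (2 ^ k)\<^sup>2 * (2 / 3 * (1 / 4) ^ k)"
        by (simp add: L2_norm_haar_term measure_corner_witness_set a_corner)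
      also have "(2 ^ k)\<^sup>2 = (4 ^ k :: real)" by (simp add: power2_eq_square flip: power_mult_distrib)
      finally show "(L2_norm (haar_term witness_set a (corner k)))\<^sup>2 = 2 / 3"
        by (simp add: power_divide)
    qed
    then show "2 * n / 3 = (\<Sum>I\<in>F. (L2_norm (haar_term witness_set a I))\<^sup>2)" by simp
  qed (simp add: zero L2_norm_def)
  moreover have "L2_has_sum (haar_term witness_set a) f dyadic"
    unfolding L2_has_sum_def
  proof (intro conjI ballI)
    show "square_integrable f"
      unfolding f_def using F by (intro square_integrable_sum square_integrable_haar_term) auto
    have "\<forall>\<^sub>F G in finite_subsets_at_top dyadic. L2_norm (\<lambda>t. (\<Sum>I\<in>G. haar_term witness_set a I t) - f t) = 0"
      unfolding eventually_finite_subsets_at_top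
    proof (intro exI[of _ F] conjI allI impI F)
      fix G assume "finite G \<and> F \<subseteq> G \<and> G \<subseteq> dyadic"
      then have "(\<Sum>I\<in>G. haar_term witness_set a I t) = f t" for t
        unfolding f_def by (intro sum.mono_neutral_right) (auto simp: zero)
      then show "L2_norm (\<lambda>t. (\<Sum>I\<in>G. haar_term witness_set a I t) - f t) = 0"
        by (simp add: L2_norm_def)
    qed
    then show "((\<lambda>G. L2_norm (\<lambda>t. (\<Sum>I\<in>G. haar_term witness_set a I t) - f t)) \<longlongrightarrow> 0) (finite_subsets_at_top dyadic)"
      by (rule tendsto_eventually)
  qed (simp add: square_integrable_haar_term)
  moreover have "(L2_norm f)\<^sup>2 \<le> 4 / 3"
  proof -
    have "f t = (\<Sum>k<n. - (2 ^ k) * haar (corner k) t) * indicator witness_set t" for t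
      unfolding f_def sum_F sum_distrib_right
      by (intro sum.cong refl) (simp add: haar_term_def a_corner)
    then show ?thesis using corner_sum_norm_le[of n] by (simp add: L2_norm_square)
  qed
  moreover have "4 / 3 < c * (2 * n / 3)" using n c by (simp add: field_simps)
  ultimately have "(L2_norm f)\<^sup>2 < c * (\<Sum>\<^sub>\<infinity>I\<in>dyadic. (L2_norm (haar_term witness_set a I))\<^sup>2)"
    unfolding infsumI[OF sum] by linarith
  then show ?thesis
    using \<open>admissible p witness_set a\<close> \<open>L2_has_sum (haar_term witness_set a) f dyadic\<close>
      has_sum_imp_summable[OF sum] by blast
qed

lemma admissible_mono: "admissible p E a \<Longrightarrow> q \<le> p \<Longrightarrow> admissible q E a"
  unfolding admissible_def
proof (intro conjI ballI impI; (elim conjE)?)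
  fix I assume "q \<le> p" and *: "\<forall>I\<in>dyadic. measure lebesgue (I \<inter> E) < p * measure lebesgue I \<longrightarrow> a I = 0"
    and I: "I \<in> dyadic" "measure lebesgue (I \<inter> E) < q * measure lebesgue I"
  have "q * measure lebesgue I \<le> p * measure lebesgue I"
    using \<open>q \<le> p\<close> by (intro mult_right_mono) auto
  with * I show "a I = 0" by auto
qed auto

theorem theorem1p1:
  shows "(\<forall>p::real. p > 2/3 \<longrightarrow>
           (\<exists>c::real. c > 0 \<and>
             (\<forall>E a. admissible p E a \<longrightarrow>
                (\<lambda>I. (L2_norm (haar_term E a I))\<^sup>2) summable_on dyadic \<longrightarrow>
                (\<exists>f. L2_has_sum (haar_term E a) f dyadic) \<and>
                (\<forall>f. L2_has_sum (haar_term E a) f dyadic \<longrightarrow>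
                   (L2_norm f)\<^sup>2 \<ge> c * (\<Sum>\<^sub>\<infinity>I\<in>dyadic. (L2_norm (haar_term E a I))\<^sup>2)))))
       \<and> (\<forall>p::real. p \<le> 2/3 \<longrightarrow>
           \<not> (\<exists>c::real. c > 0 \<and>
             (\<forall>E a. admissible p E a \<longrightarrow>
                (\<lambda>I. (L2_norm (haar_term E a I))\<^sup>2) summable_on dyadic \<longrightarrow>
                (\<forall>f. L2_has_sum (haar_term E a) f dyadic \<longrightarrow>
                   (L2_norm f)\<^sup>2 \<ge> c * (\<Sum>\<^sub>\<infinity>I\<in>dyadic. (L2_norm (haar_term E a I))\<^sup>2)))))"
proof (intro conjI allI impI)
  fix p :: real assume p: "p > 2/3"
  \<comment> \<open>densities are at most \<open>1\<close>, so the case \<open>p = 1\<close> covers all larger \<open>p\<close>\<close>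
  define q where "q = min p 1"
  have q: "2 / 3 < q" "q \<le> 1" "q \<le> p" using p by (auto simp: q_def)
  show "\<exists>c::real. c > 0 \<and>
             (\<forall>E a. admissible p E a \<longrightarrow>
                (\<lambda>I. (L2_norm (haar_term E a I))\<^sup>2) summable_on dyadic \<longrightarrow>
                (\<exists>f. L2_has_sum (haar_term E a) f dyadic) \<and>
                (\<forall>f. L2_has_sum (haar_term E a) f dyadic \<longrightarrow>
                   (L2_norm f)\<^sup>2 \<ge> c * (\<Sum>\<^sub>\<infinity>I\<in>dyadic. (L2_norm (haar_term E a I))\<^sup>2)))"
    using q lower_bound_above_two_thirds[OF q(1,2) admissible_mono[OF _ q(3)]]
    by (intro exI[of _ "((3 * q - 2) / 2)\<^sup>2"]) auto
next
  fix p :: real assume "p \<le> 2/3"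
  then show "\<not> (\<exists>c::real. c > 0 \<and>
             (\<forall>E a. admissible p E a \<longrightarrow>
                (\<lambda>I. (L2_norm (haar_term E a I))\<^sup>2) summable_on dyadic \<longrightarrow>
                (\<forall>f. L2_has_sum (haar_term E a) f dyadic \<longrightarrow>
                   (L2_norm f)\<^sup>2 \<ge> c * (\<Sum>\<^sub>\<infinity>I\<in>dyadic. (L2_norm (haar_term E a I))\<^sup>2))))"
    using no_lower_bound_up_to_two_thirds by (meson not_less)
qed

end
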